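(* For every $n\ge1$, the $S$-set $\widehat{\mathrm{Sym}}(\mathbb{Z}_{2C}^n)$ is invariant under the action of $\Delta_n$: for every $\delta_r\in\Delta_n$ and every $X_C\in\widehat{\mathrm{Sym}}(\mathbb{Z}_{2C}^n)$, one has $(\delta_rX)_C\in\widehat{\mathrm{Sym}}(\mathbb{Z}_{2C}^n)$.
   Context: $\mathbb{Z}_2=\{+,-\}=\{1,-1\}$ and $\mathbb{Z}_2^n$ is the group of $\pm1$ sequences $X=(x_0,\dots,x_{n-1})$, indices modulo $n$. $C(x_0,\dots,x_{n-1})=(x_1,\dots,x_{n-1},x_0)$ and $X_C=\{C^i(X):0\le i<n\}$; $\mathbb{Z}_{2C}^n$ is the set of all such orbits. $RX=(x_{n-1},\dots,x_1,x_0)$ is the reversal. $X_C$ is symmetric if there exists $Y\in X_C$ with $RY=Y$, and nonsymmetric otherwise; $\widehat{\mathrm{Sym}}(\mathbb{Z}_{2C}^n)$ is the set of all nonsymmetric $X_C$. $\Delta_n=\{\delta_r:\gcd(r,n)=1\}$, where $(\delta_rX)_i=x_{ri\bmod n}$; it acts on orbits by $\delta_r(X_C)=(\delta_rX)_C$. *)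

theory Defs
  imports Main
begin

text \<open>
  A sequence \<open>(x\<^sub>0, \<dots>, x\<^sub>n\<^sub>-\<^sub>1)\<close> is a list of length \<open>n\<close>; the shift \<open>C\<close> is \<^const>\<open>rotate1\<close> and the
  reversal \<open>R\<close> is \<^const>\<open>rev\<close>.
\<close>

definition Z2 :: "nat \<Rightarrow> int list set" where
  "Z2 n = {X. length X = n \<and> set X \<subseteq> {1, -1}}"

definition orbit :: "nat \<Rightarrow> int list \<Rightarrow> int list set" where
  "orbit n X = {(rotate1 ^^ i) X | i. i < n}"

definition Z2C :: "nat \<Rightarrow> int list set set" where
  "Z2C n = orbit n ` Z2 n"

definition symmetric :: "int list set \<Rightarrow> bool" where
  "symmetric XC \<longleftrightarrow> (\<exists>Y \<in> XC. rev Y = Y)"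

definition Sym_hat :: "nat \<Rightarrow> int list set set" where
  "Sym_hat n = {XC \<in> Z2C n. \<not> symmetric XC}"

definition delta :: "nat \<Rightarrow> int \<Rightarrow> int list \<Rightarrow> int list" where
  "delta n r X = map (\<lambda>i. X ! nat (r * int i mod int n)) [0..<n]"

definition Delta :: "nat \<Rightarrow> (int list \<Rightarrow> int list) set" where
  "Delta n = {delta n r | r. gcd r (int n) = 1}"

end

theory Submission imports Defs "HOL-Number_Theory.Cong" begin

text \<open>
  Extend \<open>X\<close> to an \<open>n\<close>-periodic function \<open>x\<close> on the integers. The orbit of \<open>X\<close> is symmetric iff
  \<open>x\<close> is invariant under a reflection \<open>j \<mapsto> c - j\<close> with \<open>c \<equiv> 2 k - 1\<close> modulo \<open>n\<close> for some \<open>k\<close>.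
  If \<open>\<delta>\<^sub>r X\<close> has such a reflection with constant \<open>2 k - 1\<close>, then, as \<open>r\<close> is invertible modulo \<open>n\<close>,
  \<open>x\<close> has the reflection with constant \<open>r (2 k - 1)\<close>. This constant is again of the required form:
  for odd \<open>n\<close> every residue is, and for even \<open>n\<close> both \<open>r\<close> and \<open>r (2 k - 1)\<close> are odd.
\<close>

definition per :: "'a list \<Rightarrow> int \<Rightarrow> 'a" where
  "per X j = X ! nat (j mod int (length X))"

lemma per_cong: "[i = j] (mod int (length X)) \<Longrightarrow> per X i = per X j"
  by (simp add: per_def cong_def)

lemma per_of_nat: "i < length X \<Longrightarrow> per X (int i) = X ! i"
  by (simp add: per_def)

lemma list_eq_iff_per: "length X = length Y \<Longrightarrow> X = Y \<longleftrightarrow> (\<forall>j. per X j = per Y j)"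
  by (metis nth_equalityI per_of_nat)

lemma per_rotate:
  assumes "X \<noteq> []"
  shows "per (rotate k X) j = per X (int k + j)"
proof -
  let ?n = "length X"
  have "nat (j mod int ?n) < ?n"
    using assms by (simp add: nat_less_iff)
  moreover have "int ((k + nat (j mod int ?n)) mod ?n) = (int k + j) mod int ?n"
    using assms by (simp add: zmod_int mod_add_right_eq)
  ultimately show ?thesis
    by (metis length_rotate nat_int nth_rotate per_def)
qed

lemma per_rev:
  assumes "X \<noteq> []"
  shows "per (rev X) j = per X (- 1 - j)"
proof -
  let ?n = "int (length X)"
  have n: "?n > 0" using assms by simp
  have b: "0 \<le> j mod ?n" "j mod ?n < ?n" using n by simp_all
  \<comment> \<open>\<open>rev\<close> reads position \<open>?n - 1 - j mod ?n\<close>; this already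
    lies between 0 and \<open>?n - 1\<close>, so it is the canonical residue of
    \<open>- 1 - j\<close>.\<close>
  have "(?n - 1 - j mod ?n) mod ?n = (?n + (- 1 - j)) mod ?n"
    using mod_diff_right_eq[of "?n - 1" j ?n] by (simp only: diff_conv_add_uminus add.assoc)
  then have "(- 1 - j) mod ?n = (?n - 1 - j mod ?n) mod ?n" by simp
  also have "\<dots> = ?n - 1 - j mod ?n" using b by (intro mod_pos_pos_trivial) linarith+
  finally have m: "(- 1 - j) mod ?n = ?n - 1 - j mod ?n" .
  have "nat (j mod ?n) < length X" using b by linarith
  moreover have "length X - Suc (nat (j mod ?n)) = nat (?n - 1 - j mod ?n)" using b by linarith
  ultimately show ?thesis by (simp add: per_def m rev_nth)
qed

lemma per_delta:
  assumes "length X = n" "n > 0"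
  shows "per (delta n r X) j = per X (r * j)"
proof -
  have "nat (j mod int n) < n" using assms by (simp add: nat_less_iff)
  then show ?thesis using assms by (simp add: per_def delta_def mod_mult_right_eq)
qed

lemma delta_in_Z2:
  assumes "X \<in> Z2 n" "n > 0"
  shows "delta n r X \<in> Z2 n"
proof -
  have "nat (i mod int n) < n" for i using assms(2) by (simp add: nat_less_iff)
  then have "X ! nat (i mod int n) \<in> {1, -1}" for i
    using assms(1) nth_mem unfolding Z2_def by blast
  then show ?thesis by (auto simp: Z2_def delta_def)
qed

text \<open>Reversing \<open>rotate i X\<close> sends the entry at \<open>i + j\<close> to
  \<open>i - 1 - j\<close>; the two arguments add up to the constant \<open>2 * i - 1\<close>.
  Letting \<open>k\<close> range over all integers frees later arguments from the bound
  \<open>i < n\<close>.\<close>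

lemma symmetric_orbit_iff:
  assumes "length X = n" "n > 0"
  shows "symmetric (orbit n X) \<longleftrightarrow> (\<exists>k. \<forall>j. per X (k - 1 - j) = per X (k + j))"
proof -
  have ne: "X \<noteq> []" using assms by auto
  have rot: "rev (rotate i X) = rotate i X \<longleftrightarrow> (\<forall>j. per X (int i - 1 - j) = per X (int i + j))" for i
    using ne by (simp add: list_eq_iff_per per_rev per_rotate algebra_simps)
  have "symmetric (orbit n X) \<longleftrightarrow> (\<exists>i<n. rev (rotate i X) = rotate i X)"
    by (auto simp: symmetric_def orbit_def rotate_def)
  also have "\<dots> \<longleftrightarrow> (\<exists>k. \<forall>j. per X (k - 1 - j) = per X (k + j))"
  proof
    assume "\<exists>k. \<forall>j. per X (k - 1 - j) = per X (k + j)"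
    then obtain k where k: "per X (k - 1 - j) = per X (k + j)" for j by blast
    \<comment> \<open>Periodicity allows the centre \<open>k\<close> to be replaced by its residue,
      which is an admissible shift.\<close>
    let ?i = "nat (k mod int n)"
    have c: "[int ?i = k] (mod int (length X))" using assms by (simp add: cong_def)
    have "per X (int ?i - 1 - j) = per X (int ?i + j)" for j
      using k[of j] per_cong[OF cong_diff[OF cong_diff[OF c cong_refl[of 1]] cong_refl[of j]]]
        per_cong[OF cong_add[OF c cong_refl[of j]]] by simp
    moreover have "?i < n" using assms by (simp add: nat_less_iff)
    ultimately show "\<exists>i<n. rev (rotate i X) = rotate i X" using rot by blast
  qed (use rot in blast)
  finally show ?thesis .
qed

text \<open>If \<open>r\<close> is odd, the product is itself odd. If \<open>r\<close> is even,
  coprimality makes \<open>n\<close> odd, and adding \<open>n\<close> to the even product gives an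
  odd representative.\<close>

lemma reflection_constant_mult:
  fixes r n k :: int
  assumes "coprime r n"
  obtains m where "[2 * m - 1 = r * (2 * k - 1)] (mod n)"
proof (cases "odd r")
  case True
  then have "even (r * (2 * k - 1) + 1)" by simp
  from even_two_times_div_two[OF this]
  have "2 * ((r * (2 * k - 1) + 1) div 2) - 1 = r * (2 * k - 1)" by linarith
  then show ?thesis using that by (metis cong_refl)
next
  case False
  then have "odd n" using assms by (meson coprime_common_divisor odd_one)
  with False have "even (r * (2 * k - 1) + n + 1)" by simp
  from even_two_times_div_two[OF this]
  have "2 * ((r * (2 * k - 1) + n + 1) div 2) - 1 = r * (2 * k - 1) + n" by linarith
  then show ?thesis using that by (metis cong_def mod_add_self2)
qed

lemma symmetric_orbit_deltaD:
  assumes X: "length X = n" "n > 0" and r: "coprime r (int n)"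
    and sym: "symmetric (orbit n (delta n r X))"
  shows "symmetric (orbit n X)"
proof -
  have "length (delta n r X) = n" by (simp add: delta_def)
  then obtain k where k: "per X (r * (k - 1 - j)) = per X (r * (k + j))" for j
    using sym X by (auto simp: symmetric_orbit_iff per_delta)
  obtain m where m: "[2 * m - 1 = r * (2 * k - 1)] (mod int n)"
    using reflection_constant_mult[OF r] .
  obtain s where s: "[r * s = 1] (mod int n)"
    using r cong_solve_coprime_int by blast
  have "per X (m - 1 - j) = per X (m + j)" for j
  proof -
    \<comment> \<open>With \<open>s\<close> inverse to \<open>r\<close>, this solves
      \<open>r * (k + ?i)\<close> \<equiv> \<open>m + j\<close>. The mirrored argument is then
      \<open>r * (2 * k - 1) - r * (k + ?i)\<close> \<equiv> \<open>(2 * m - 1) - (m + j)\<close>,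
      that is, \<open>m - 1 - j\<close>.\<close>
    let ?i = "s * (m + j) - k"
    have rs: "[r * s * (m + j) = m + j] (mod int n)"
      using cong_scalar_right[OF s, of "m + j"] by simp
    then have "[r * (k + ?i) = m + j] (mod int n)" by (simp add: algebra_simps)
    moreover have "[r * (k - 1 - ?i) = m - 1 - j] (mod int n)"
      using cong_diff[OF cong_sym[OF m] rs] by (simp add: algebra_simps)
    ultimately show ?thesis using k[of ?i] X by (metis per_cong)
  qed
  then show ?thesis using X by (auto simp: symmetric_orbit_iff)
qed

theorem corollary7:
  fixes n :: nat
  assumes "n \<ge> 1"
  shows "\<forall>\<delta> \<in> Delta n. \<forall>X \<in> Z2 n. orbit n X \<in> Sym_hat n \<longrightarrow> orbit n (\<delta> X) \<in> Sym_hat n"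
proof (intro ballI impI)
  fix \<delta> X
  assume "\<delta> \<in> Delta n" and X: "X \<in> Z2 n" and ns: "orbit n X \<in> Sym_hat n"
  then obtain r where \<delta>: "\<delta> = delta n r" and r: "coprime r (int n)"
    by (auto simp: Delta_def coprime_iff_gcd_eq_1)
  have "length X = n" using X by (simp add: Z2_def)
  then have "\<not> symmetric (orbit n (\<delta> X))"
    using symmetric_orbit_deltaD[OF _ _ r] ns assms by (auto simp: Sym_hat_def \<delta>)
  then show "orbit n (\<delta> X) \<in> Sym_hat n"
    using delta_in_Z2[OF X] assms by (auto simp: Sym_hat_def Z2C_def \<delta>)
qed

end
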